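(* Let $n\ge 1$ and consider sparse matrix spaces in $\mathbb{R}^{n\times n}$. (1) The least dimension of a minimally stable sparse matrix space is $n$. (2) The least codimension of a maximally unstable sparse matrix space is $n$. (3) There is no maximally unstable sparse matrix space $\Sigma_\alpha$ having exactly one free variable on the diagonal (that is, with exactly one $i$ such that $(i,i)\in\alpha$) and whose codimension $c$ satisfies $n\le c<2n-2$.
   Context: For $\alpha\subset\{1,\dots,n\}\times\{1,\dots,n\}$, the sparse matrix space (SMS) $\Sigma_\alpha\subset\mathbb{R}^{n\times n}$ is the vector space of real $n\times n$ matrices $A=(a_{ij})$ with $a_{ij}=0$ whenever $(i,j)\notin\alpha$; the entries indexed by $\alpha$ are called free variables. Its dimension is $|\alpha|$ and its codimension is $n^2-|\alpha|$. A real square matrix is stable if all its eigenvalues have strictly negative real part. An SMS is stable if it contains a stable matrix, and unstable otherwise. An SMS $\Sigma_\alpha$ is minimally stable if it is stable and no SMS $\Sigma_\beta\subsetneq\Sigma_\alpha$ is stable. An SMS $\Sigma_\alpha$ is maximally unstable if it is unstable and no SMS $\Sigma_\beta\supsetneq\Sigma_\alpha$ (in $\mathbb{R}^{n\times n}$) is unstable. *)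

theory Defs
  imports "Jordan_Normal_Form.Char_Poly" "Jordan_Normal_Form.VS_Connect"
begin

(* Rows and columns are numbered from 0, as everywhere in Jordan_Normal_Form:
   the position (i, j) here is the position (i + 1, j + 1) of the usual numbering. *)
definition positions :: "nat \<Rightarrow> (nat \<times> nat) set" where
  "positions n = {0..<n} \<times> {0..<n}"

definition sms :: "nat \<Rightarrow> (nat \<times> nat) set \<Rightarrow> real mat set" where
  "sms n \<alpha> = {A \<in> carrier_mat n n. \<forall>i<n. \<forall>j<n. (i, j) \<notin> \<alpha> \<longrightarrow> A $$ (i, j) = 0}"

(* The dimension as a real vector space; sms_dim_eq_card shows that it is the number of
   free variables. *)
definition sms_dim :: "nat \<Rightarrow> (nat \<times> nat) set \<Rightarrow> nat" where
  "sms_dim n \<alpha> = vectorspace.dim class_ring ((module_mat TYPE(real) n n)\<lparr>carrier := sms n \<alpha>\<rparr>)"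

definition sms_codim :: "nat \<Rightarrow> (nat \<times> nat) set \<Rightarrow> nat" where
  "sms_codim n \<alpha> = n\<^sup>2 - sms_dim n \<alpha>"

definition stable_mat :: "real mat \<Rightarrow> bool" where
  "stable_mat A \<longleftrightarrow> (\<forall>k. eigenvalue (map_mat complex_of_real A) k \<longrightarrow> Re k < 0)"

definition stable_sms :: "nat \<Rightarrow> (nat \<times> nat) set \<Rightarrow> bool" where
  "stable_sms n \<alpha> \<longleftrightarrow> (\<exists>A\<in>sms n \<alpha>. stable_mat A)"

definition minimally_stable :: "nat \<Rightarrow> (nat \<times> nat) set \<Rightarrow> bool" where
  "minimally_stable n \<alpha> \<longleftrightarrow> \<alpha> \<subseteq> positions n \<and> stable_sms n \<alpha> \<and>
     (\<forall>\<beta>\<subseteq>positions n. sms n \<beta> \<subset> sms n \<alpha> \<longrightarrow> \<not> stable_sms n \<beta>)"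

definition maximally_unstable :: "nat \<Rightarrow> (nat \<times> nat) set \<Rightarrow> bool" where
  "maximally_unstable n \<alpha> \<longleftrightarrow> \<alpha> \<subseteq> positions n \<and> \<not> stable_sms n \<alpha> \<and>
     (\<forall>\<beta>\<subseteq>positions n. sms n \<alpha> \<subset> sms n \<beta> \<longrightarrow> stable_sms n \<beta>)"

context
  fixes n :: nat
begin

interpretation V: matrix_vs n n "TYPE(real)" .

private lemma finsum_mat_index:
  assumes "finite B" "f \<in> B \<rightarrow> carrier_mat n n" "i < n" "j < n"
  shows "finsum V.V f B $$ (i, j) = (\<Sum>b\<in>B. f b $$ (i, j)) \<and> finsum V.V f B \<in> carrier_mat n n"
  using assms(1,2)
proof (induction B)
  case empty
  then show ?case using assms(3,4) V.finsum_empty by simp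
next
  case (insert x F)
  have "finsum V.V f (insert x F) = f x + finsum V.V f F"
    by (rule V.finsum_insert) (use insert in auto)
  moreover have "finsum V.V f F \<in> carrier_mat n n"
    and "finsum V.V f F $$ (i, j) = (\<Sum>b\<in>F. f b $$ (i, j))"
    and "f x \<in> carrier_mat n n"
    using insert by auto
  ultimately show ?case using insert(1,2) assms(3,4)
    by (simp add: index_add_mat(1)[of i _ j])
qed

private lemma sms_subspace: "VectorSpace.subspace class_ring (sms n \<alpha>) V.V"
proof -
  have "submodule class_ring (sms n \<alpha>) V.V"
    by (intro submodule.intro V.module_axioms)
       (auto simp: sms_def matrix_vs_simps)
  then show ?thesis
    using V.vectorspace_axioms by (simp add: VectorSpace.subspace_def)
qed

lemma sms_dim_eq_card:
  assumes "\<alpha> \<subseteq> positions n"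
  shows "sms_dim n \<alpha> = card \<alpha>"
proof -
  define E :: "nat \<times> nat \<Rightarrow> real mat" where "E p = mat n n (\<lambda>q. if q = p then 1 else 0)" for p
  have lt: "fst p < n" "snd p < n" if "p \<in> \<alpha>" for p
    using assms that by (auto simp: positions_def)
  have E_index: "E p $$ (i, j) = (if (i, j) = p then 1 else 0)" if "i < n" "j < n" for p i j
    using that by (simp add: E_def)
  have E_carrier [simp]: "E p \<in> carrier_mat n n" for p
    by (simp add: E_def)
  have inj: "inj_on E \<alpha>"
  proof (rule inj_onI)
    fix p q assume pq: "p \<in> \<alpha>" "q \<in> \<alpha>" "E p = E q"
    have "E p $$ (fst p, snd p) = E q $$ (fst p, snd p)" using pq by simp
    then show "p = q" using E_index[OF lt[OF pq(1)]] by (auto split: if_splits)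
  qed
  have fin: "finite \<alpha>"
    using assms by (rule finite_subset) (simp add: positions_def)
  define B where "B = E ` \<alpha>"
  have B_fin: "finite B" and B_car: "B \<subseteq> carrier_mat n n" and B_card: "card B = card \<alpha>"
    using fin inj by (auto simp: B_def card_image)
  have B_sms: "B \<subseteq> sms n \<alpha>"
    by (auto simp: B_def sms_def E_index)
  have lincomb_index: "V.lincomb a B $$ (i, j) = (if (i, j) \<in> \<alpha> then a (E (i, j)) else 0)"
    if "i < n" "j < n" for a i j
  proof -
    have "V.lincomb a B $$ (i, j) = (\<Sum>b\<in>B. (a b \<cdot>\<^sub>m b) $$ (i, j))"
      unfolding V.lincomb_def
      using finsum_mat_index[of B "\<lambda>b. a b \<cdot>\<^sub>m b" i j] that B_fin B_car by auto
    also have "\<dots> = (\<Sum>p\<in>\<alpha>. (a (E p) \<cdot>\<^sub>m E p) $$ (i, j))"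
      unfolding B_def by (rule sum.reindex_cong[OF inj]) auto
    also have "\<dots> = (\<Sum>p\<in>\<alpha>. if (i, j) = p then a (E p) else 0)"
    proof (rule sum.cong)
      fix p
      have "(a (E p) \<cdot>\<^sub>m E p) $$ (i, j) = a (E p) * E p $$ (i, j)"
        using that by (subst index_smult_mat) (auto simp: E_def)
      then show "(a (E p) \<cdot>\<^sub>m E p) $$ (i, j) = (if (i, j) = p then a (E p) else 0)"
        using E_index[OF that] by simp
    qed simp
    also have "\<dots> = (if (i, j) \<in> \<alpha> then a (E (i, j)) else 0)"
      using fin by simp
    finally show ?thesis .
  qed
  have lincomb_car: "V.lincomb a B \<in> carrier_mat n n" for a
    using V.lincomb_closed[of B a] B_car by simp
  have indpt: "\<not> V.lin_dep B"
  proof (rule V.finite_lin_indpt2[OF B_fin])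
    show "B \<subseteq> carrier_mat n n" by (rule B_car)
    fix a assume a: "V.lincomb a B = 0\<^sub>m n n"
    show "\<forall>v\<in>B. a v = 0"
    proof
      fix v assume "v \<in> B"
      then obtain p where p: "p \<in> \<alpha>" "v = E p" by (auto simp: B_def)
      show "a v = 0"
        using lincomb_index[OF lt[OF p(1)], of a] p lt[OF p(1)] by (cases p) (simp add: a)
    qed
  qed
  have span: "V.span B = sms n \<alpha>"
  proof
    show "V.span B \<subseteq> sms n \<alpha>"
      using V.span_is_subset[OF B_sms] sms_subspace by (simp add: VectorSpace.subspace_def)
    show "sms n \<alpha> \<subseteq> V.span B"
    proof
      fix A assume A: "A \<in> sms n \<alpha>"
      define a where "a M = A $$ (inv_into \<alpha> E M)" for M
      have "A = V.lincomb a B"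
      proof (rule eq_matI)
        fix i j assume "i < dim_row (V.lincomb a B)" "j < dim_col (V.lincomb a B)"
        then have "i < n" "j < n" using lincomb_car[of a] by auto
        then show "A $$ (i, j) = V.lincomb a B $$ (i, j)"
          using A inj by (auto simp: lincomb_index a_def sms_def)
      qed (use A lincomb_car[of a] in \<open>auto simp: sms_def\<close>)
      then show "A \<in> V.span B"
        using B_fin by (auto simp: V.span_def)
    qed
  qed
  have sub: "submodule class_ring (sms n \<alpha>) V.V"
    using sms_subspace by (simp add: VectorSpace.subspace_def)
  interpret W: vectorspace "class_ring :: real ring" "V.vs (sms n \<alpha>)"
    by (rule V.subspace_is_vs[OF sms_subspace])
  have "W.basis B"
    unfolding W.basis_def
    using V.span_li_not_depend[OF B_sms sub] span indpt B_sms by simp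
  then have "W.dim = card B"
    by (rule W.dim_basis[OF B_fin])
  then show ?thesis
    by (simp add: sms_dim_def B_card)
qed

end

end

theory Submission
  imports
    "HOL-Analysis.Topology_Euclidean_Space"
    "Jordan_Normal_Form.Schur_Decomposition"
    Defs
begin

text \<open>
  A stable matrix is nonsingular, so some term of the Leibniz expansion of its determinant is
  nonzero, which takes \<open>n\<close> free positions; and the diagonal space contains \<open>- 1\<close>.  This settles
  the least dimension.  A stable matrix also has negative trace, so the space of all matrices with
  zero diagonal is unstable, of codimension \<open>n\<close>.

  Everything else follows from \<open>stable_sms_if_few_missing_arcs\<close>: one free diagonal entry suffices
  for stability if at most \<open>n - 2\<close> off-diagonal positions are forced to vanish.  Indeed, an unstable
  space has a zero on the diagonal (otherwise it contains \<open>- 1\<close>).  If its codimension were less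
  than \<open>n\<close>, some diagonal entry would be free and at most \<open>n - 2\<close> off-diagonal positions would
  vanish.  A space with exactly one free diagonal entry spends \<open>n - 1\<close> of its codimension on the
  diagonal, so that a codimension below \<open>2 * n - 2\<close> leaves at most \<open>n - 2\<close> off-diagonal zeros.
  The same lemma shows that the space with zero diagonal is maximal.

  The lemma is proved by building a stable matrix one vertex at a time.  View a position \<open>(i, j)\<close>
  as an arc of a digraph on \<open>n\<close> vertices.  There are \<open>n - 1\<close> nontrivial cyclic shifts
  \<open>i \<mapsto> i + k mod n\<close>, and they use pairwise disjoint sets of arcs, so when at most \<open>n - 2\<close> arcs are
  missing, one of the shifts uses only arcs that are present (\<open>derangement_avoiding_few_arcs\<close>).
  Deleting an endpoint of a missing arc, other than a chosen vertex whose diagonal entry is free,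
  lowers both the number of vertices and the number of missing arcs (if none is missing, any other
  vertex will do), so the remaining space is stable by induction.
  Finally, \<open>stable_sms_extend\<close> adds the deleted vertex: if the leading block is stable and a
  permutation is supported on the free positions, a small multiple of the permutation matrix makes
  the whole matrix nonsingular without destabilizing the block.  Multiplying the last row by a small
  factor of the right sign then keeps all eigenvalues but one near those of the block and puts the
  remaining one slightly to the left of \<open>0\<close>.
\<close>

section \<open>Stable matrices under perturbation\<close>

lemma char_matrix_index:
  assumes "A \<in> carrier_mat n n" "i < n" "j < n"
  shows "char_matrix A z $$ (i, j) = A $$ (i, j) - (if i = j then z else 0)"
  using assms by (simp add: char_matrix_def)

lemma stable_mat_iff_det:
  assumes "A \<in> carrier_mat n n"
  shows "stable_mat A \<longleftrightarrow> (\<forall>z. 0 \<le> Re z \<longrightarrow> det (char_matrix (map_mat complex_of_real A) z) \<noteq> 0)"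
proof -
  have "map_mat complex_of_real A \<in> carrier_mat n n" using assms by simp
  from eigenvalue_det[OF this] show ?thesis
    unfolding stable_mat_def by (meson not_less)
qed

lemma continuous_on_det:
  fixes M :: "'a::topological_space \<Rightarrow> complex mat"
  assumes "\<And>x. M x \<in> carrier_mat n n"
    and "\<And>i j. i < n \<Longrightarrow> j < n \<Longrightarrow> continuous_on S (\<lambda>x. M x $$ (i, j))"
  shows "continuous_on S (\<lambda>x. det (M x))"
proof -
  have eq: "(\<lambda>x. det (M x)) =
      (\<lambda>x. \<Sum>p\<in>{p. p permutes {0..<n}}. signof p * (\<Prod>i = 0..<n. M x $$ (i, p i)))"
    using det_def'[OF assms(1)] by blast
  show ?thesis unfolding eq
  proof (intro continuous_on_sum continuous_on_mult continuous_on_const continuous_on_prod)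
    fix p i assume "p \<in> {p. p permutes {0..<n}}" "i \<in> {0..<n}"
    then show "continuous_on S (\<lambda>x. M x $$ (i, p i))"
      using permutes_in_image[of p "{0..<n}" i] by (intro assms(2)) auto
  qed
qed

text \<open>
  Any bound that depends continuously on the entries would do: it confines the unstable eigenvalues
  of all small perturbations of a matrix to one compact half disc.
\<close>

lemma norm_eigenvalue_le_sum_entries:
  fixes A :: "complex mat"
  assumes A: "A \<in> carrier_mat n n" and ev: "eigenvalue A z"
  shows "norm z \<le> (\<Sum>i<n. \<Sum>j<n. norm (A $$ (i, j)))"
proof -
  obtain v where v: "v \<in> carrier_vec n" "v \<noteq> 0\<^sub>v n" "A *\<^sub>v v = z \<cdot>\<^sub>v v"
    using ev A by (auto simp: eigenvalue_def eigenvector_def)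
  define s where "s = (\<Sum>i<n. norm (v $ i))"
  have "\<exists>i<n. v $ i \<noteq> 0" using v(1,2) by (metis carrier_vecD eq_vecI index_zero_vec)
  then have pos: "s > 0" unfolding s_def
    by (metis finite_lessThan lessThan_iff norm_ge_zero sum_pos2 zero_less_norm_iff)
  have row: "norm z * norm (v $ i) \<le> (\<Sum>j<n. norm (A $$ (i, j))) * s" if i: "i < n" for i
  proof -
    have "z * v $ i = (A *\<^sub>v v) $ i" using v i by simp
    also have "\<dots> = (\<Sum>j<n. A $$ (i, j) * v $ j)"
      using A v(1) i by (simp add: scalar_prod_def atLeast0LessThan)
    finally have "norm z * norm (v $ i) \<le> (\<Sum>j<n. norm (A $$ (i, j)) * norm (v $ j))"
      by (metis (no_types, lifting) norm_mult norm_sum sum.cong)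
    also have "\<dots> \<le> (\<Sum>j<n. norm (A $$ (i, j)) * s)"
      unfolding s_def by (intro sum_mono mult_left_mono member_le_sum) auto
    finally show ?thesis by (simp add: sum_distrib_right)
  qed
  have "norm z * s = (\<Sum>i<n. norm z * norm (v $ i))"
    by (simp add: s_def sum_distrib_left)
  also have "\<dots> \<le> (\<Sum>i<n. (\<Sum>j<n. norm (A $$ (i, j))) * s)"
    using row by (intro sum_mono) auto
  finally have "norm z * s \<le> (\<Sum>i<n. \<Sum>j<n. norm (A $$ (i, j))) * s"
    by (simp add: sum_distrib_right)
  then show ?thesis using pos by simp
qed

lemma compact_right_half_disc: "compact {z. 0 \<le> Re z \<and> norm z \<le> R}"
proof -
  have "{z. 0 \<le> Re z \<and> norm z \<le> R} = {z. 0 \<le> Re z} \<inter> cball 0 R" by auto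
  moreover have "closed {z. 0 \<le> Re z}"
    by (intro closed_Collect_le continuous_intros)
  ultimately show ?thesis by (simp add: closed_Int_compact)
qed

text \<open>
  The characteristic determinant of \<open>A\<close> has no zero on the half disc to which unstable eigenvalues
  are confined.  Its modulus is therefore bounded below there, and uniform continuity in the pair
  \<open>(t, z)\<close> keeps it away from \<open>0\<close> for small \<open>t\<close>.
\<close>

lemma stable_mat_perturb:
  assumes A: "A \<in> carrier_mat n n" and B: "B \<in> carrier_mat n n" and st: "stable_mat A"
  shows "\<exists>\<delta>>0. \<forall>t. \<bar>t\<bar> < \<delta> \<longrightarrow> stable_mat (A + t \<cdot>\<^sub>m B)"
proof -
  define M where "M t = map_mat complex_of_real (A + t \<cdot>\<^sub>m B)" for t
  define g where "g = (\<lambda>(t, z). det (char_matrix (M t) z))"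
  define R where "R = (\<Sum>i<n. \<Sum>j<n. \<bar>A $$ (i, j)\<bar> + \<bar>B $$ (i, j)\<bar>)"
  define K where "K = {z. 0 \<le> Re z \<and> norm z \<le> R}"
  have M_car: "M t \<in> carrier_mat n n" for t using A B by (simp add: M_def)
  have M_idx: "M t $$ (i, j) = of_real (A $$ (i, j) + t * B $$ (i, j))" if "i < n" "j < n" for t i j
    using A B that by (simp add: M_def)
  have bound: "norm z \<le> R" if "\<bar>t\<bar> \<le> 1" "det (char_matrix (M t) z) = 0" for t z
  proof -
    have "norm z \<le> (\<Sum>i<n. \<Sum>j<n. norm (M t $$ (i, j)))"
      using norm_eigenvalue_le_sum_entries[OF M_car] that(2) eigenvalue_det[OF M_car] by blast
    also have "\<dots> \<le> R" unfolding R_def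
    proof (intro sum_mono)
      fix i j assume "i \<in> {..<n}" "j \<in> {..<n}"
      then have "norm (M t $$ (i, j)) = \<bar>A $$ (i, j) + t * B $$ (i, j)\<bar>"
        by (simp only: M_idx lessThan_iff norm_of_real)
      also have "\<dots> \<le> \<bar>A $$ (i, j)\<bar> + \<bar>t\<bar> * \<bar>B $$ (i, j)\<bar>"
        by (metis abs_mult abs_triangle_ineq)
      also have "\<dots> \<le> \<bar>A $$ (i, j)\<bar> + \<bar>B $$ (i, j)\<bar>"
        using that(1) by (simp add: mult_left_le_one_le)
      finally show "norm (M t $$ (i, j)) \<le> \<bar>A $$ (i, j)\<bar> + \<bar>B $$ (i, j)\<bar>" .
    qed
    finally show ?thesis .
  qed
  have "R \<ge> 0" unfolding R_def by (intro sum_nonneg) auto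
  then have K: "compact K" "0 \<in> K" by (auto simp: K_def compact_right_half_disc)
  have cont: "continuous_on ({-1..1} \<times> K) g" unfolding g_def case_prod_beta
  proof (rule continuous_on_det)
    fix i j assume "i < n" "j < n"
    then have eq: "(\<lambda>x. char_matrix (M (fst x)) (snd x) $$ (i, j)) =
        (\<lambda>x. of_real (A $$ (i, j) + fst x * B $$ (i, j)) - snd x * (if i = j then 1 else 0))"
      using M_car by (auto simp: char_matrix_index[OF M_car] M_idx fun_eq_iff)
    show "continuous_on ({-1..1} \<times> K) (\<lambda>x. char_matrix (M (fst x)) (snd x) $$ (i, j))"
      unfolding eq by (intro continuous_intros)
  qed (use M_car in auto)
  have M0: "M 0 = map_mat complex_of_real A" using A B by (intro eq_matI) (auto simp: M_def)
  have nz: "g (0, z) \<noteq> 0" if "z \<in> K" for z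
    using st that by (auto simp: stable_mat_iff_det[OF A] g_def M0 K_def)
  have "continuous_on K (\<lambda>z. norm (g (0, z)))"
    by (intro continuous_on_norm continuous_on_compose2[OF cont]) (auto intro!: continuous_intros)
  then obtain w where w: "w \<in> K" "\<And>z. z \<in> K \<Longrightarrow> norm (g (0, w)) \<le> norm (g (0, z))"
    using continuous_attains_inf[OF K(1)] K(2) by blast
  have "uniformly_continuous_on ({-1..1} \<times> K) g"
    using K(1) by (intro compact_uniformly_continuous cont compact_Times) auto
  moreover have "norm (g (0, w)) > 0" using nz w(1) by simp
  ultimately obtain d where d: "d > 0"
    "\<And>x y. x \<in> {-1..1} \<times> K \<Longrightarrow> y \<in> {-1..1} \<times> K \<Longrightarrow> dist y x < d \<Longrightarrow>
       dist (g y) (g x) < norm (g (0, w))"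
    unfolding uniformly_continuous_on_def by metis
  have "stable_mat (A + t \<cdot>\<^sub>m B)" if t: "\<bar>t\<bar> < min d 1" for t
  proof -
    have "det (char_matrix (M t) z) \<noteq> 0" if z: "0 \<le> Re z" for z
    proof
      assume eq: "det (char_matrix (M t) z) = 0"
      then have "z \<in> K" using z t bound[of t z] by (simp add: K_def)
      moreover have "dist (t, z) (0, z) < d" using t by (simp add: dist_Pair_Pair)
      ultimately have "dist (g (t, z)) (g (0, z)) < norm (g (0, w))"
        using t by (intro d(2)) auto
      moreover have "g (t, z) = 0" using eq by (simp add: g_def)
      ultimately show False using w(2)[OF \<open>z \<in> K\<close>] by simp
    qed
    then show ?thesis
      using stable_mat_iff_det[of "A + t \<cdot>\<^sub>m B" n] A B by (auto simp: M_def)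
  qed
  then show ?thesis using d(1) by (intro exI[of _ "min d 1"]) auto
qed

text \<open>
  Expanding along the scaled row turns the characteristic equation into \<open>z * p z = \<epsilon> * q z\<close>, where
  \<open>p\<close> is the characteristic determinant of the leading block and \<open>q 0 = det N\<close>.  On the right half
  plane \<open>p\<close> does not vanish, so a root there satisfies \<open>z = \<epsilon> * (q z / p z)\<close>.  As the quotient is
  bounded, \<open>z\<close> is close to \<open>0\<close>, where the quotient is close to the nonzero real number
  \<open>s = q 0 / p 0\<close>.  If \<open>\<epsilon>\<close> has the sign opposite to \<open>s\<close>, then \<open>Re z < 0\<close>, a contradiction.
\<close>

lemma stable_mat_scale_last_row:
  assumes N: "N \<in> carrier_mat (Suc n) (Suc n)"
    and st: "stable_mat (mat n n (\<lambda>p. N $$ p))" and det: "det N \<noteq> 0"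
  shows "\<exists>\<epsilon>. stable_mat (mat (Suc n) (Suc n) (\<lambda>(i, j). (if i = n then \<epsilon> else 1) * N $$ (i, j)))"
proof -
  define A where "A = mat n n (\<lambda>p. N $$ p)"
  define r where "r \<epsilon> = mat (Suc n) (Suc n) (\<lambda>(i, j). (if i = n then \<epsilon> else 1) * N $$ (i, j))"
    for \<epsilon> :: real
  define M where "M \<epsilon> z = char_matrix (map_mat complex_of_real (r \<epsilon>)) z" for \<epsilon> z
  define c where "c z j = cofactor (M 1 z) n j" for z j
  define p where "p z = c z n" for z
  define q where "q z = (\<Sum>j<Suc n. of_real (N $$ (n, j)) * c z j)" for z
  have A: "A \<in> carrier_mat n n" by (simp add: A_def)
  have A_idx: "A $$ (i, j) = N $$ (i, j)" if "i < n" "j < n" for i j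
    using that by (simp add: A_def)
  have r_car: "map_mat complex_of_real (r \<epsilon>) \<in> carrier_mat (Suc n) (Suc n)" for \<epsilon>
    by (simp add: r_def)
  have M_car: "M \<epsilon> z \<in> carrier_mat (Suc n) (Suc n)" for \<epsilon> z
    using r_car by (simp add: M_def)
  have M_idx: "M \<epsilon> z $$ (i, j) =
      of_real ((if i = n then \<epsilon> else 1) * N $$ (i, j)) - (if i = j then z else 0)"
    if "i < Suc n" "j < Suc n" for \<epsilon> z i j
    using that by (simp add: M_def char_matrix_index[OF r_car]) (simp add: r_def)
  \<comment> \<open>Cofactors of the last row do not see that row, hence do not depend on \<open>\<epsilon>\<close>.\<close>
  have cof: "cofactor (M \<epsilon> z) n j = c z j" if "j < Suc n" for \<epsilon> z j
  proof -
    have "mat_delete (M \<epsilon> z) n j = mat_delete (M 1 z) n j"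
      using M_car[of \<epsilon> z] M_car[of 1 z] that
      by (intro eq_matI) (auto simp: mat_delete_def M_idx)
    then show ?thesis by (simp add: c_def cofactor_def)
  qed
  have expand: "det (M \<epsilon> z) = of_real \<epsilon> * q z - z * p z" for \<epsilon> z
  proof -
    have "det (M \<epsilon> z) = (\<Sum>j<Suc n. M \<epsilon> z $$ (n, j) * cofactor (M \<epsilon> z) n j)"
      by (rule laplace_expansion_row[OF M_car]) simp
    also have "\<dots> = (\<Sum>j<Suc n. of_real \<epsilon> * (of_real (N $$ (n, j)) * c z j)
        - (if n = j then z * c z j else 0))"
      by (intro sum.cong) (auto simp: M_idx cof algebra_simps)
    also have "\<dots> = of_real \<epsilon> * q z - z * p z"
      by (simp add: sum_subtractf q_def p_def sum_distrib_left algebra_simps)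
    finally show ?thesis .
  qed
  have p_eq: "p z = det (char_matrix (map_mat complex_of_real A) z)" for z
  proof -
    have A': "map_mat complex_of_real A \<in> carrier_mat n n" using A by simp
    have cA: "char_matrix (map_mat complex_of_real A) z \<in> carrier_mat n n" using A' by simp
    have "mat_delete (M 1 z) n n = char_matrix (map_mat complex_of_real A) z"
      using M_car[of 1 z]
      by (intro eq_matI)
        (auto simp: mat_delete_def M_idx char_matrix_index[OF A'] carrier_matD[OF cA] carrier_matD[OF A] A_idx)
    then show ?thesis by (simp add: p_def c_def cofactor_def)
  qed
  have p_nz: "p z \<noteq> 0" if "0 \<le> Re z" for z
    using st that by (simp add: p_eq stable_mat_iff_det[OF A] A_def[symmetric])
  have q0: "q 0 = of_real (det N)"
  proof -
    have "M 1 0 = map_mat complex_of_real N"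
      using M_car[of 1 0] N by (intro eq_matI) (auto simp: M_idx)
    then have "det (M 1 0) = of_real (det N)" by simp
    then show ?thesis using expand[of 1 0] by simp
  qed
  have p0: "p 0 = of_real (det A)"
  proof -
    have "char_matrix (map_mat complex_of_real A) 0 = map_mat complex_of_real A"
      using A by (intro eq_matI) (auto simp: char_matrix_def)
    then show ?thesis by (simp add: p_eq)
  qed
  define s where "s = det N / det A"
  have s: "q 0 / p 0 = of_real s" "s \<noteq> 0"
    using det p_nz[of 0] by (auto simp: q0 p0 s_def)
  have cont_c: "continuous_on S (\<lambda>z. c z j)" if "j < Suc n" for S j
    unfolding c_def cofactor_def
  proof (intro continuous_on_mult continuous_on_const continuous_on_det)
    show "mat_delete (M 1 z) n j \<in> carrier_mat n n" for z
      using mat_delete_carrier[OF M_car[of 1 z], of n j] by simp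
    fix i k assume "i < n" "k < n"
    then have eq: "(\<lambda>z. mat_delete (M 1 z) n j $$ (i, k)) =
        (\<lambda>z. of_real (N $$ (i, if k < j then k else Suc k))
          - z * (if i = (if k < j then k else Suc k) then 1 else 0))"
      using M_car by (auto simp: mat_delete_def M_idx carrier_matD[OF M_car])
    show "continuous_on S (\<lambda>z. mat_delete (M 1 z) n j $$ (i, k))"
      unfolding eq by (intro continuous_intros)
  qed
  define R where "R = (\<Sum>i<Suc n. \<Sum>j<Suc n. \<bar>N $$ (i, j)\<bar>)"
  define K where "K = {z. 0 \<le> Re z \<and> norm z \<le> R}"
  have "R \<ge> 0" unfolding R_def by (intro sum_nonneg) auto
  then have K: "compact K" "0 \<in> K" by (auto simp: K_def compact_right_half_disc)
  have in_K: "z \<in> K" if "\<bar>\<epsilon>\<bar> \<le> 1" "0 \<le> Re z" "det (M \<epsilon> z) = 0" for \<epsilon> z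
  proof -
    have "norm z \<le> (\<Sum>i<Suc n. \<Sum>j<Suc n. norm (map_mat complex_of_real (r \<epsilon>) $$ (i, j)))"
      using that(3) unfolding M_def eigenvalue_det[OF r_car, symmetric]
      by (rule norm_eigenvalue_le_sum_entries[OF r_car])
    also have "\<dots> \<le> R" unfolding R_def using that(1)
      by (intro sum_mono) (auto simp: r_def norm_mult mult_left_le_one_le)
    finally show ?thesis using that(2) by (simp add: K_def)
  qed
  define h where "h z = q z / p z" for z
  have cont_h: "continuous_on K h"
    unfolding h_def q_def p_def using p_nz
    by (intro continuous_intros cont_c) (auto simp: K_def p_def)
  then have "bounded (h ` K)"
    using K(1) by (intro compact_imp_bounded compact_continuous_image)
  then obtain C where C: "C > 0" "\<And>z. z \<in> K \<Longrightarrow> norm (h z) \<le> C"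
    unfolding bounded_pos by auto
  obtain \<eta> where \<eta>: "\<eta> > 0" "\<And>z. z \<in> K \<Longrightarrow> dist z 0 < \<eta> \<Longrightarrow> dist (h z) (h 0) < \<bar>s\<bar>"
    using cont_h K(2) s(2) unfolding continuous_on_iff by (metis zero_less_abs_iff)
  define e where "e = min 1 (\<eta> / (2 * C))"
  have e: "e > 0" "e \<le> 1" "e * C < \<eta>"
    using C(1) \<eta>(1) by (auto simp: e_def field_simps min_def)
  define \<epsilon> where "\<epsilon> = - sgn s * e"
  have abs_eps: "\<bar>\<epsilon>\<bar> = e" using e(1) s(2) by (simp add: \<epsilon>_def abs_mult sgn_if)
  have "det (M \<epsilon> z) \<noteq> 0" if z: "0 \<le> Re z" for z
  proof
    assume root: "det (M \<epsilon> z) = 0"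
    then have zK: "z \<in> K" using z abs_eps e(2) by (intro in_K) auto
    have z_eq: "z = of_real \<epsilon> * h z"
      using root p_nz[OF z] by (simp add: expand h_def field_simps)
    then have "norm z = e * norm (h z)"
      using abs_eps by (metis norm_mult norm_of_real)
    also have "\<dots> \<le> e * C" using C(2)[OF zK] e(1) by (intro mult_left_mono) auto
    finally have "dist z 0 < \<eta>" using e(3) by simp
    from \<eta>(2)[OF zK this] have "norm (h z - of_real s) < \<bar>s\<bar>"
      using s(1) by (simp add: h_def dist_norm)
    then have "\<bar>Re (h z) - s\<bar> < \<bar>s\<bar>"
      using abs_Re_le_cmod[of "h z - of_real s"] by simp
    then have "sgn s * Re (h z) > 0" by (auto simp: sgn_if)
    then have "e * (sgn s * Re (h z)) > 0" by (rule mult_pos_pos[OF e(1)])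
    moreover have "Re z = - (e * (sgn s * Re (h z)))"
      by (subst z_eq) (simp add: \<epsilon>_def)
    ultimately show False using z by linarith
  qed
  then have "stable_mat (r \<epsilon>)"
    using stable_mat_iff_det[of "r \<epsilon>" "Suc n"] by (auto simp: M_def r_def)
  then show ?thesis unfolding r_def by blast
qed

section \<open>Operations that preserve stability of a sparse matrix space\<close>

text \<open>
  With \<open>P\<close> the permutation matrix, \<open>(U + t P) v = 0\<close> for a nonzero \<open>v\<close> says that \<open>t\<close> is an eigenvalue of
  \<open>- P\<^sup>-\<^sup>1 U\<close>, which is \<open>U\<close> with permuted rows and opposite sign.
\<close>

lemma finitely_many_singular_permutation_shifts:
  fixes U :: "real mat"
  assumes U: "U \<in> carrier_mat n n" and \<sigma>: "\<sigma> permutes {0..<n}"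
  shows "finite {t. det (U + t \<cdot>\<^sub>m mat n n (\<lambda>(i, j). if j = \<sigma> i then 1 else 0)) = 0}"
proof -
  define P :: "real mat" where "P = mat n n (\<lambda>(i, j). if j = \<sigma> i then 1 else 0)"
  define B where "B = mat n n (\<lambda>(i, j). - U $$ (Hilbert_Choice.inv \<sigma> i, j))"
  have B: "B \<in> carrier_mat n n" by (simp add: B_def)
  have P: "P \<in> carrier_mat n n" by (simp add: P_def)
  have lt: "\<sigma> i < n \<longleftrightarrow> i < n" "Hilbert_Choice.inv \<sigma> i < n \<longleftrightarrow> i < n" for i
    using permutes_in_image[OF \<sigma>, of i] permutes_in_image[OF permutes_inv[OF \<sigma>], of i] by auto
  have "eigenvalue B t" if singular: "det (U + t \<cdot>\<^sub>m P) = 0" for t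
  proof -
    have car: "U + t \<cdot>\<^sub>m P \<in> carrier_mat n n" using U P by simp
    obtain v where v: "v \<in> carrier_vec n" "v \<noteq> 0\<^sub>v n" "(U + t \<cdot>\<^sub>m P) *\<^sub>v v = 0\<^sub>v n"
      using singular det_0_iff_vec_prod_zero_field[OF car] by blast
    have row: "(\<Sum>j = 0..<n. U $$ (i, j) * v $ j) + t * v $ \<sigma> i = 0" if i: "i < n" for i
    proof -
      have "0 = ((U + t \<cdot>\<^sub>m P) *\<^sub>v v) $ i" using v(3) i by simp
      also have "\<dots> = (\<Sum>j = 0..<n. (U + t \<cdot>\<^sub>m P) $$ (i, j) * v $ j)"
        using v(1) i U P by (simp add: scalar_prod_def)
      also have "\<dots> = (\<Sum>j = 0..<n. U $$ (i, j) * v $ j + (if j = \<sigma> i then t * v $ j else 0))"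
        using U i by (intro sum.cong) (auto simp: P_def algebra_simps)
      also have "\<dots> = (\<Sum>j = 0..<n. U $$ (i, j) * v $ j) + t * v $ \<sigma> i"
        using i by (simp add: sum.distrib lt)
      finally show ?thesis by simp
    qed
    have "B *\<^sub>v v = t \<cdot>\<^sub>v v"
    proof (rule eq_vecI)
      fix i assume "i < dim_vec (t \<cdot>\<^sub>v v)"
      then have i: "i < n" using v(1) by simp
      have "(B *\<^sub>v v) $ i = - (\<Sum>j = 0..<n. U $$ (Hilbert_Choice.inv \<sigma> i, j) * v $ j)"
        using v(1) i by (simp add: scalar_prod_def B_def sum_negf)
      also have "\<dots> = t * v $ i"
        using row[of "Hilbert_Choice.inv \<sigma> i"] i lt permutes_inverses(1)[OF \<sigma>] by simp
      finally show "(B *\<^sub>v v) $ i = (t \<cdot>\<^sub>v v) $ i" using v(1) i by simp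
    qed (use v(1) B in auto)
    then show ?thesis using v B by (auto simp: eigenvalue_def eigenvector_def)
  qed
  then have "{t. det (U + t \<cdot>\<^sub>m P) = 0} \<subseteq> {t. poly (char_poly B) t = 0}"
    using eigenvalue_root_char_poly[OF B] by auto
  moreover have "char_poly B \<noteq> 0"
    using degree_monic_char_poly[OF B] by auto
  ultimately show ?thesis
    using poly_roots_finite finite_subset unfolding P_def by blast
qed

text \<open>
  A stable matrix on the first \<open>n\<close> indices, bordered by zeros, has \<open>0\<close> as an additional eigenvalue.
  The permutation is used only to make the bordered matrix nonsingular; scaling the last row then
  moves the additional eigenvalue into the left half plane.
\<close>

lemma stable_sms_extend:
  assumes st: "stable_sms n \<beta>" and \<sigma>: "\<sigma> permutes {0..<Suc n}"
    and cover: "\<And>i. i < Suc n \<Longrightarrow> (i, \<sigma> i) \<in> \<beta>"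
  shows "stable_sms (Suc n) \<beta>"
proof -
  obtain A where A: "A \<in> carrier_mat n n" "stable_mat A"
    and A0: "\<And>i j. i < n \<Longrightarrow> j < n \<Longrightarrow> (i, j) \<notin> \<beta> \<Longrightarrow> A $$ (i, j) = 0"
    using st by (auto simp: stable_sms_def sms_def)
  define U where
    "U = mat (Suc n) (Suc n) (\<lambda>(i, j). if i < n \<and> j < n then A $$ (i, j) else 0)"
  define P :: "real mat" where
    "P = mat (Suc n) (Suc n) (\<lambda>(i, j). if j = \<sigma> i then 1 else 0)"
  have U: "U \<in> carrier_mat (Suc n) (Suc n)" by (simp add: U_def)
  obtain \<delta> where \<delta>: "\<delta> > 0"
    "\<And>t. \<bar>t\<bar> < \<delta> \<Longrightarrow> stable_mat (A + t \<cdot>\<^sub>m mat n n (\<lambda>p. P $$ p))"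
    using stable_mat_perturb[OF A(1) _ A(2), of "mat n n (\<lambda>p. P $$ p)"] by auto
  have "infinite {0<..<\<delta>}" using \<delta>(1) by simp
  moreover have "finite {t. det (U + t \<cdot>\<^sub>m P) = 0}"
    unfolding P_def by (rule finitely_many_singular_permutation_shifts[OF U \<sigma>])
  ultimately have "\<not> {0<..<\<delta>} \<subseteq> {t. det (U + t \<cdot>\<^sub>m P) = 0}"
    using finite_subset by blast
  then obtain t where t: "t \<in> {0<..<\<delta>}" "det (U + t \<cdot>\<^sub>m P) \<noteq> 0" by blast
  \<comment> \<open>So small a \<open>t\<close> keeps the leading block stable, and the shift by \<open>t P\<close> is nonsingular.\<close>
  define N where "N = U + t \<cdot>\<^sub>m P"
  have N: "N \<in> carrier_mat (Suc n) (Suc n)" by (simp add: N_def U_def P_def)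
  have "mat n n (\<lambda>p. N $$ p) = A + t \<cdot>\<^sub>m mat n n (\<lambda>p. P $$ p)"
    using A(1) by (intro eq_matI) (auto simp: N_def U_def P_def)
  then have "stable_mat (mat n n (\<lambda>p. N $$ p))" using \<delta>(2)[of t] t(1) by simp
  from stable_mat_scale_last_row[OF N this] t(2) obtain \<epsilon> where
    "stable_mat (mat (Suc n) (Suc n) (\<lambda>(i, j). (if i = n then \<epsilon> else 1) * N $$ (i, j)))"
    by (auto simp: N_def)
  moreover have "mat (Suc n) (Suc n) (\<lambda>(i, j). (if i = n then \<epsilon> else 1) * N $$ (i, j))
      \<in> sms (Suc n) \<beta>"
    using A0 cover by (auto simp: sms_def N_def U_def P_def)
  ultimately show ?thesis unfolding stable_sms_def by blast
qed

lemma stable_sms_relabel: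
  assumes g: "g permutes {0..<n}" and st: "stable_sms n {(i, j). (g i, g j) \<in> \<alpha>}"
  shows "stable_sms n \<alpha>"
proof -
  obtain A where A: "A \<in> carrier_mat n n" "stable_mat A"
    and A0: "\<And>i j. i < n \<Longrightarrow> j < n \<Longrightarrow> (g i, g j) \<notin> \<alpha> \<Longrightarrow> A $$ (i, j) = 0"
    using st by (auto simp: stable_sms_def sms_def)
  define B where "B = mat n n (\<lambda>(i, j). A $$ (Hilbert_Choice.inv g i, Hilbert_Choice.inv g j))"
  have lt: "g i < n \<longleftrightarrow> i < n" "Hilbert_Choice.inv g i < n \<longleftrightarrow> i < n" for i
    using permutes_in_image[OF g, of i] permutes_in_image[OF permutes_inv[OF g], of i] by auto
  note gi [simp] = permutes_inverses[OF g]
  have "B \<in> sms n \<alpha>" using A0 lt by (auto simp: sms_def B_def)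
  moreover have "stable_mat B" unfolding stable_mat_def
  proof (intro allI impI)
    fix z assume "eigenvalue (map_mat complex_of_real B) z"
    then obtain v where v: "v \<in> carrier_vec n" "v \<noteq> 0\<^sub>v n"
        "map_mat complex_of_real B *\<^sub>v v = z \<cdot>\<^sub>v v"
      by (auto simp: eigenvalue_def eigenvector_def B_def)
    define w where "w = vec n (\<lambda>i. v $ g i)"
    have "\<exists>i<n. v $ i \<noteq> 0" using v(1,2) by (metis carrier_vecD eq_vecI index_zero_vec)
    then obtain i where "i < n" "v $ i \<noteq> 0" by blast
    then have "w $ Hilbert_Choice.inv g i \<noteq> 0" "Hilbert_Choice.inv g i < n" by (simp_all add: w_def lt)
    then have "w \<noteq> 0\<^sub>v n" by auto
    moreover have "map_mat complex_of_real A *\<^sub>v w = z \<cdot>\<^sub>v w"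
    proof (rule eq_vecI)
      fix i assume "i < dim_vec (z \<cdot>\<^sub>v w)"
      then have i: "i < n" by (simp add: w_def)
      have "(map_mat complex_of_real A *\<^sub>v w) $ i
          = (\<Sum>j = 0..<n. of_real (A $$ (i, j)) * v $ g j)"
        using A(1) i by (simp add: w_def scalar_prod_def)
      also have "\<dots> = (\<Sum>j = 0..<n. of_real (A $$ (i, Hilbert_Choice.inv g j)) * v $ j)"
        using sum.permute[OF g, of "\<lambda>j. of_real (A $$ (i, Hilbert_Choice.inv g j)) * v $ j"] by (simp add: o_def)
      also have "\<dots> = (map_mat complex_of_real B *\<^sub>v v) $ g i"
        using i v(1) lt by (simp add: B_def scalar_prod_def)
      also have "\<dots> = (z \<cdot>\<^sub>v w) $ i" using v i by (simp add: w_def lt)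
      finally show "(map_mat complex_of_real A *\<^sub>v w) $ i = (z \<cdot>\<^sub>v w) $ i" .
    qed (use A(1) in \<open>simp add: w_def\<close>)
    moreover have "w \<in> carrier_vec n" by (simp add: w_def)
    ultimately have "eigenvalue (map_mat complex_of_real A) z"
      using A(1) by (auto simp: eigenvalue_def eigenvector_def)
    then show "Re z < 0" using A(2) by (simp add: stable_mat_def)
  qed
  ultimately show ?thesis by (auto simp: stable_sms_def)
qed

lemma stable_sms_if_diagonal:
  assumes "\<And>i. i < n \<Longrightarrow> (i, i) \<in> \<alpha>"
  shows "stable_sms n \<alpha>"
proof -
  define A :: "real mat" where "A = - 1\<^sub>m n"
  have "char_matrix (map_mat complex_of_real A) z = (-1 - z) \<cdot>\<^sub>m 1\<^sub>m n" for z
    by (intro eq_matI) (auto simp: A_def char_matrix_def)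
  then have det: "det (char_matrix (map_mat complex_of_real A) z) = (-1 - z) ^ n" for z
    by simp
  have "-1 - z \<noteq> 0" if "0 \<le> Re z" for z :: complex
    using that by (auto simp: complex_eq_iff)
  then have "stable_mat A" 
    using stable_mat_iff_det[of A n] by (simp add: det) (simp add: A_def)
  moreover have "A \<in> sms n \<alpha>" using assms by (auto simp: A_def sms_def)
  ultimately show ?thesis by (auto simp: stable_sms_def)
qed

section \<open>Spaces with few off-diagonal zeros\<close>

text \<open>Loops are excluded, because the zeros on the diagonal are counted separately.\<close>

definition missing_arcs :: "nat \<Rightarrow> (nat \<times> nat) set \<Rightarrow> (nat \<times> nat) set" where
  "missing_arcs n \<alpha> = {(i, j). i < n \<and> j < n \<and> i \<noteq> j \<and> (i, j) \<notin> \<alpha>}"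

lemma finite_missing_arcs [simp]: "finite (missing_arcs n \<alpha>)"
  by (rule finite_subset[of _ "{..<n} \<times> {..<n}"]) (auto simp: missing_arcs_def)

text \<open>
  The arc \<open>(i, j)\<close> belongs to exactly one cyclic shift, the one by \<open>j - i\<close> modulo \<open>n\<close>.  Hence \<open>X\<close>
  meets at most \<open>card X\<close> of the \<open>n - 1\<close> nontrivial shifts.
\<close>

lemma derangement_avoiding_few_arcs:
  assumes fin: "finite X" and card: "card X < n - 1"
  shows "\<exists>\<sigma>. \<sigma> permutes {0..<n} \<and> (\<forall>i<n. \<sigma> i \<noteq> i \<and> (i, \<sigma> i) \<notin> X)"
proof -
  define s where "s = (\<lambda>(i, j). (j + n - i) mod n)"
  have "card (s ` X) < card {1..<n}" using card_image_le[OF fin, of s] card by simp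
  then have "\<not> {1..<n} \<subseteq> s ` X" using fin by (meson card_mono finite_imageI not_less)
  then obtain k where k: "0 < k" "k < n" "k \<notin> s ` X" by force
  define \<sigma> where "\<sigma> i = (if i < n then (i + k) mod n else i)" for i
  have s: "s (i, \<sigma> i) = k" if "i < n" for i
    using that k(2) by (auto simp: s_def \<sigma>_def mod_if)
  have "inj_on \<sigma> {0..<n}"
    using k(2) by (auto simp: inj_on_def \<sigma>_def mod_if split: if_splits)
  moreover have "\<sigma> ` {0..<n} \<subseteq> {0..<n}" by (auto simp: \<sigma>_def)
  ultimately have "bij_betw \<sigma> {0..<n} {0..<n}"
    by (simp add: bij_betw_def endo_inj_surj)
  then have "\<sigma> permutes {0..<n}" by (rule bij_imp_permutes) (simp add: \<sigma>_def)
  moreover have "\<sigma> i \<noteq> i \<and> (i, \<sigma> i) \<notin> X" if "i < n" for i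
    using s[OF that] k that image_eqI[of k s "(i, \<sigma> i)" X] by (auto simp: \<sigma>_def mod_if)
  ultimately show ?thesis by blast
qed

text \<open>
  The induction removes a vertex \<open>v\<close>, different from \<open>r\<close> and incident to a missing arc if there is
  one.  Transposing \<open>v\<close> with the last index makes the smaller space a leading block.  For \<open>n = 1\<close>,
  where \<open>n - 2\<close> truncates to \<open>0\<close>, no off-diagonal position exists, and the bound holds
  automatically.
\<close>

lemma stable_sms_if_few_missing_arcs:
  assumes "r < n" "(r, r) \<in> \<alpha>" "card (missing_arcs n \<alpha>) \<le> n - 2"
  shows "stable_sms n \<alpha>"
  using assms
proof (induction n arbitrary: r \<alpha>)
  case 0
  then show ?case by simp
next
  case (Suc n)
  show ?case
  proof (cases "n = 0")
    case True
    then show ?thesis using Suc.prems by (intro stable_sms_if_diagonal) auto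
  next
    case False
    \<comment> \<open>A missing arc is not a loop, so at least one of its endpoints differs from \<open>r\<close>.\<close>
    have "\<exists>v<Suc n. v \<noteq> r \<and> (missing_arcs (Suc n) \<alpha> = {} \<or>
        (\<exists>e\<in>missing_arcs (Suc n) \<alpha>. v = fst e \<or> v = snd e))"
    proof (cases "missing_arcs (Suc n) \<alpha> = {}")
      case True
      then show ?thesis using False by (intro exI[of _ "if r = 0 then 1 else 0"]) auto
    next
      case False
      then obtain i j where ij: "(i, j) \<in> missing_arcs (Suc n) \<alpha>" by auto
      then show ?thesis
        by (intro exI[of _ "if i = r then j else i"])
          (auto simp: missing_arcs_def intro!: bexI[of _ "(i, j)"])
    qed
    then obtain v where v: "v < Suc n" "v \<noteq> r"
      and inc: "missing_arcs (Suc n) \<alpha> = {} \<or>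
        (\<exists>e\<in>missing_arcs (Suc n) \<alpha>. v = fst e \<or> v = snd e)" by blast
    define \<tau> where "\<tau> = Transposition.transpose v n"
    define \<beta> where "\<beta> = {(i, j). (\<tau> i, \<tau> j) \<in> \<alpha>}"
    have \<tau>: "\<tau> permutes {0..<Suc n}"
      unfolding \<tau>_def using v(1) by (intro permutes_swap_id) auto
    have \<tau>_lt: "\<tau> i < Suc n \<longleftrightarrow> i < Suc n" for i
      using permutes_in_image[OF \<tau>, of i] by auto
    have \<tau>_inj: "\<tau> i = \<tau> j \<longleftrightarrow> i = j" for i j
      using permutes_inj[OF \<tau>] by (auto simp: inj_def)
    have \<tau>n: "\<tau> n = v" and \<tau>\<tau>: "\<tau> (\<tau> i) = i" for i by (auto simp: \<tau>_def)
    have inj: "inj_on (map_prod \<tau> \<tau>) S" for S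
      by (auto simp: inj_on_def \<tau>_inj)
    have sub: "map_prod \<tau> \<tau> ` missing_arcs (Suc n) \<beta> \<subseteq> missing_arcs (Suc n) \<alpha>"
      by (auto simp: missing_arcs_def \<beta>_def \<tau>_lt \<tau>_inj)
    have sub': "map_prod \<tau> \<tau> ` missing_arcs n \<beta> \<subseteq>
        missing_arcs (Suc n) \<alpha> - {e. v = fst e \<or> v = snd e}"
    proof -
      have "\<tau> i \<noteq> v" if "i < n" for i using that \<tau>_inj[of i n] \<tau>n by simp
      moreover have "\<tau> i < Suc n" if "i < n" for i using that \<tau>_lt[of i] by simp
      ultimately show ?thesis by (force simp: missing_arcs_def \<beta>_def \<tau>_inj)
    qed
    have "card (missing_arcs n \<beta>) \<le> card (missing_arcs (Suc n) \<alpha> - {e. v = fst e \<or> v = snd e})"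
      by (rule card_inj_on_le[OF inj sub']) simp
    also have "\<dots> \<le> n - 2"
    proof (cases "missing_arcs (Suc n) \<alpha> = {}")
      case False
      then have "card (missing_arcs (Suc n) \<alpha> - {e. v = fst e \<or> v = snd e}) <
          card (missing_arcs (Suc n) \<alpha>)"
        using inc by (intro psubset_card_mono) auto
      then show ?thesis using Suc.prems(3) by linarith
    qed simp
    finally have few: "card (missing_arcs n \<beta>) \<le> n - 2" .
    have "\<tau> r \<noteq> n" using v(2) \<tau>n \<tau>\<tau> by metis
    then have "\<tau> r < n" using \<tau>_lt[of r] Suc.prems(1) by simp
    moreover have "(\<tau> r, \<tau> r) \<in> \<beta>" using Suc.prems(2) by (simp add: \<beta>_def \<tau>\<tau>)
    ultimately have st: "stable_sms n \<beta>" using few by (rule Suc.IH)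
    have "card (missing_arcs (Suc n) \<beta>) \<le> card (missing_arcs (Suc n) \<alpha>)"
      by (rule card_inj_on_le[OF inj sub]) simp
    then have "card (missing_arcs (Suc n) \<beta>) < Suc n - 1" using Suc.prems(3) False by linarith
    then obtain \<sigma> where \<sigma>: "\<sigma> permutes {0..<Suc n}"
      "\<And>i. i < Suc n \<Longrightarrow> \<sigma> i \<noteq> i \<and> (i, \<sigma> i) \<notin> missing_arcs (Suc n) \<beta>"
      using derangement_avoiding_few_arcs[OF finite_missing_arcs] by blast
    have "(i, \<sigma> i) \<in> \<beta>" if "i < Suc n" for i
      using \<sigma>(2)[OF that] permutes_in_image[OF \<sigma>(1), of i] that by (auto simp: missing_arcs_def)
    then have "stable_sms (Suc n) \<beta>" by (rule stable_sms_extend[OF st \<sigma>(1)])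
    then show ?thesis using stable_sms_relabel[OF \<tau>] by (simp add: \<beta>_def)
  qed
qed

section \<open>Necessary conditions for stability\<close>

lemma trace_mult_commute:
  fixes X Y :: "'a::comm_semiring_0 mat"
  assumes X: "X \<in> carrier_mat n m" and Y: "Y \<in> carrier_mat m n"
  shows "(\<Sum>i = 0..<n. (X * Y) $$ (i, i)) = (\<Sum>j = 0..<m. (Y * X) $$ (j, j))"
proof -
  have "(\<Sum>i = 0..<n. (X * Y) $$ (i, i)) = (\<Sum>i = 0..<n. \<Sum>j = 0..<m. X $$ (i, j) * Y $$ (j, i))"
    using X Y by (intro sum.cong) (auto simp: scalar_prod_def)
  also have "\<dots> = (\<Sum>j = 0..<m. \<Sum>i = 0..<n. Y $$ (j, i) * X $$ (i, j))"
    by (subst sum.swap) (simp add: mult.commute)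
  also have "\<dots> = (\<Sum>j = 0..<m. (Y * X) $$ (j, j))"
    using X Y by (intro sum.cong) (auto simp: scalar_prod_def)
  finally show ?thesis .
qed

text \<open>
  By Schur triangularization the trace is the sum of the eigenvalues, taken with multiplicity.
\<close>

lemma trace_neg_if_stable:
  assumes A: "A \<in> carrier_mat n n" and st: "stable_mat A" and n: "n > 0"
  shows "(\<Sum>i = 0..<n. A $$ (i, i)) < 0"
proof -
  define C where "C = map_mat complex_of_real A"
  have C: "C \<in> carrier_mat n n" using A by (simp add: C_def)
  obtain es where es: "char_poly C = (\<Prod>a\<leftarrow>es. [:- a, 1:])" "length es = n"
    using char_poly_factorized[OF C] by blast
  obtain B P Q where "schur_decomposition C es = (B, P, Q)" by (metis prod_cases3)
  with schur_decomposition[OF C es(1)] have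
    wit: "similar_mat_wit C B P Q" and diag: "diag_mat B = es" by auto
  have w: "Q * P = 1\<^sub>m n" "C = P * B * Q"
    and car: "B \<in> carrier_mat n n" "P \<in> carrier_mat n n" "Q \<in> carrier_mat n n"
    using similar_mat_witD2[OF C wit] by blast+
  have PB: "P * B \<in> carrier_mat n n" using car by simp
  have "(\<Sum>i = 0..<n. C $$ (i, i)) = (\<Sum>j = 0..<n. (Q * (P * B)) $$ (j, j))"
    unfolding w(2) by (rule trace_mult_commute[OF PB car(3)])
  also have "Q * (P * B) = (Q * P) * B"
    by (rule assoc_mult_mat[OF car(3,2,1), symmetric])
  also have "\<dots> = B" unfolding w(1) using car(1) by simp
  also have "(\<Sum>j = 0..<n. B $$ (j, j)) = (\<Sum>j = 0..<n. es ! j)"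
    using car(1) by (intro sum.cong) (auto simp: diag[symmetric] diag_mat_def)
  finally have "(\<Sum>i = 0..<n. A $$ (i, i)) = (\<Sum>j = 0..<n. Re (es ! j))"
    using A by (simp add: C_def complex_eq_iff)
  also have "\<dots> < (\<Sum>j = 0..<n. 0)"
  proof (rule sum_strict_mono)
    fix j assume j: "j \<in> {0..<n}"
    then have "poly (char_poly C) (es ! j) = 0"
      using es by (auto simp: poly_prod_list prod_list_zero_iff intro!: image_eqI[of _ _ "es ! j"])
    then show "Re (es ! j) < 0"
      using st eigenvalue_root_char_poly[OF C] by (auto simp: stable_mat_def C_def)
  qed (use n in auto)
  finally show ?thesis by simp
qed

lemma card_ge_if_stable_sms:
  assumes st: "stable_sms n \<alpha>" and fin: "finite \<alpha>"
  shows "n \<le> card \<alpha>"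
proof -
  obtain A where A: "A \<in> carrier_mat n n" "stable_mat A"
    and A0: "\<And>i j. i < n \<Longrightarrow> j < n \<Longrightarrow> (i, j) \<notin> \<alpha> \<Longrightarrow> A $$ (i, j) = 0"
    using st by (auto simp: stable_sms_def sms_def)
  have "char_matrix (map_mat complex_of_real A) 0 = map_mat complex_of_real A"
    using A(1) by (intro eq_matI) (auto simp: char_matrix_def)
  moreover have "det (char_matrix (map_mat complex_of_real A) 0) \<noteq> 0"
    using A(2) stable_mat_iff_det[OF A(1)] by simp
  ultimately have "det A \<noteq> 0" by simp
  then obtain p where p: "p permutes {0..<n}" "(\<Prod>i = 0..<n. A $$ (i, p i)) \<noteq> 0"
    unfolding det_def'[OF A(1)] by (metis (no_types, lifting) mem_Collect_eq mult_zero_right sum.neutral)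
  have "(\<lambda>i. (i, p i)) ` {0..<n} \<subseteq> \<alpha>"
  proof clarify
    fix i assume "i \<in> {0..<n}"
    then show "(i, p i) \<in> \<alpha>"
      using p(2) A0[of i "p i"] permutes_in_image[OF p(1), of i] by auto
  qed
  then have "card ((\<lambda>i. (i, p i)) ` {0..<n}) \<le> card \<alpha>" using fin by (intro card_mono)
  then show ?thesis by (subst (asm) card_image) (auto simp: inj_on_def)
qed

section \<open>Extremal dimensions\<close>

text \<open>
  Minimality and maximality refer to inclusion of the matrix spaces; this turns them into statements
  about sets of positions.
\<close>

lemma sms_psubset_iff:
  assumes "\<alpha> \<subseteq> positions n" "\<beta> \<subseteq> positions n"
  shows "sms n \<alpha> \<subset> sms n \<beta> \<longleftrightarrow> \<alpha> \<subset> \<beta>"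
proof -
  have le: "sms n \<alpha> \<subseteq> sms n \<beta> \<longleftrightarrow> \<alpha> \<subseteq> \<beta>" if "\<alpha> \<subseteq> positions n" for \<alpha> \<beta>
  proof
    assume sub: "sms n \<alpha> \<subseteq> sms n \<beta>"
    have "mat n n (\<lambda>p. if p \<in> \<alpha> then 1 else 0) \<in> sms n \<alpha>" by (auto simp: sms_def)
    with sub have "mat n n (\<lambda>p. if p \<in> \<alpha> then 1 else 0) \<in> sms n \<beta>" by blast
    then show "\<alpha> \<subseteq> \<beta>" using that by (fastforce simp: sms_def positions_def)
  qed (auto simp: sms_def)
  show ?thesis using le[OF assms(1)] le[OF assms(2)] by blast
qed

lemma card_positions [simp]: "card (positions n) = n\<^sup>2"
  by (simp add: positions_def power2_eq_square)

lemma finite_positions [simp]: "finite (positions n)"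
  by (simp add: positions_def)

lemma sms_codim_eq_card:
  assumes "\<alpha> \<subseteq> positions n"
  shows "sms_codim n \<alpha> = card {i. i < n \<and> (i, i) \<notin> \<alpha>} + card (missing_arcs n \<alpha>)"
proof -
  have "positions n - \<alpha> = (\<lambda>i. (i, i)) ` {i. i < n \<and> (i, i) \<notin> \<alpha>} \<union> missing_arcs n \<alpha>"
    by (auto simp: positions_def missing_arcs_def)
  moreover have "card ((\<lambda>i. (i, i)) ` {i. i < n \<and> (i, i) \<notin> \<alpha>} \<union> missing_arcs n \<alpha>)
      = card {i. i < n \<and> (i, i) \<notin> \<alpha>} + card (missing_arcs n \<alpha>)"
  proof (subst card_Un_disjoint)
    show "(\<lambda>i. (i, i)) ` {i. i < n \<and> (i, i) \<notin> \<alpha>} \<inter> missing_arcs n \<alpha> = {}"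
      by (auto simp: missing_arcs_def)
  qed (simp_all add: card_image inj_on_def)
  moreover have "card (positions n - \<alpha>) = n\<^sup>2 - card \<alpha>"
    using assms finite_subset[OF assms] by (simp add: card_Diff_subset)
  ultimately show ?thesis
    using assms by (simp add: sms_codim_def sms_dim_eq_card)
qed

theorem theorem5:
  fixes n :: nat
  assumes "n \<ge> 1"
  shows
    "((\<exists>\<alpha>. minimally_stable n \<alpha> \<and> sms_dim n \<alpha> = n) \<and>
      (\<forall>\<alpha>. minimally_stable n \<alpha> \<longrightarrow> n \<le> sms_dim n \<alpha>)) \<and>
     ((\<exists>\<alpha>. maximally_unstable n \<alpha> \<and> sms_codim n \<alpha> = n) \<and>
      (\<forall>\<alpha>. maximally_unstable n \<alpha> \<longrightarrow> n \<le> sms_codim n \<alpha>)) \<and>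
     (\<nexists>\<alpha>. maximally_unstable n \<alpha> \<and> (\<exists>!i. (i, i) \<in> \<alpha>) \<and>
        n \<le> sms_codim n \<alpha> \<and> sms_codim n \<alpha> < 2 * n - 2)"
proof (intro conjI allI impI notI)
  define D where "D = (\<lambda>i. (i, i)) ` {0..<n}"
  have D: "D \<subseteq> positions n" "card D = n" "finite D"
    by (auto simp: D_def positions_def card_image inj_on_def)
  have "\<not> stable_sms n \<beta>" if "\<beta> \<subseteq> positions n" "sms n \<beta> \<subset> sms n D" for \<beta>
  proof
    assume st: "stable_sms n \<beta>"
    have "\<beta> \<subset> D" using that sms_psubset_iff[OF that(1) D(1)] by simp
    then have "card \<beta> < n" using psubset_card_mono[OF D(3)] D(2) by metis
    moreover have "finite \<beta>" using \<open>\<beta> \<subset> D\<close> D(3) finite_subset by blast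
    ultimately show False using card_ge_if_stable_sms[OF st] by simp
  qed
  moreover have "stable_sms n D" by (rule stable_sms_if_diagonal) (auto simp: D_def)
  ultimately have "minimally_stable n D" using D(1) by (simp add: minimally_stable_def)
  moreover have "sms_dim n D = n" using sms_dim_eq_card[OF D(1)] D(2) by simp
  ultimately show "\<exists>\<alpha>. minimally_stable n \<alpha> \<and> sms_dim n \<alpha> = n" by blast
next
  fix \<alpha> assume "minimally_stable n \<alpha>"
  then have "\<alpha> \<subseteq> positions n" "stable_sms n \<alpha>" by (auto simp: minimally_stable_def)
  then show "n \<le> sms_dim n \<alpha>"
    using card_ge_if_stable_sms finite_subset[OF _ finite_positions] by (simp add: sms_dim_eq_card)
next
  define \<Omega> where "\<Omega> = {(i, j). i < n \<and> j < n \<and> i \<noteq> j}"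
  have \<Omega>: "\<Omega> \<subseteq> positions n" by (auto simp: \<Omega>_def positions_def)
  have "\<not> stable_sms n \<Omega>"
  proof
    assume "stable_sms n \<Omega>"
    then obtain A where A: "A \<in> sms n \<Omega>" "stable_mat A" by (auto simp: stable_sms_def)
    then have "(\<Sum>i = 0..<n. A $$ (i, i)) < 0"
      using trace_neg_if_stable[of A n] assms by (auto simp: sms_def)
    then show False using A(1) by (simp add: sms_def \<Omega>_def)
  qed
  moreover have "stable_sms n \<beta>" if \<beta>: "\<beta> \<subseteq> positions n" "sms n \<Omega> \<subset> sms n \<beta>" for \<beta>
  proof -
    have "\<Omega> \<subset> \<beta>" using \<beta> sms_psubset_iff[OF \<Omega> \<beta>(1)] by simp
    then obtain i j where ij: "(i, j) \<in> \<beta>" "(i, j) \<notin> \<Omega>" by auto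
    with \<beta>(1) have "i < n" "i = j" by (auto simp: \<Omega>_def positions_def)
    moreover have "missing_arcs n \<beta> = {}" using \<open>\<Omega> \<subset> \<beta>\<close> by (auto simp: missing_arcs_def \<Omega>_def)
    ultimately show ?thesis using ij(1) stable_sms_if_few_missing_arcs[of i n \<beta>] by simp
  qed
  ultimately have "maximally_unstable n \<Omega>" using \<Omega> by (simp add: maximally_unstable_def)
  moreover have "missing_arcs n \<Omega> = {}" "{i. i < n \<and> (i, i) \<notin> \<Omega>} = {..<n}"
    by (auto simp: \<Omega>_def missing_arcs_def)
  then have "sms_codim n \<Omega> = n" by (simp add: sms_codim_eq_card[OF \<Omega>])
  ultimately show "\<exists>\<alpha>. maximally_unstable n \<alpha> \<and> sms_codim n \<alpha> = n" by blast
next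
  fix \<alpha> assume "maximally_unstable n \<alpha>"
  then have \<alpha>: "\<alpha> \<subseteq> positions n" "\<not> stable_sms n \<alpha>" by (auto simp: maximally_unstable_def)
  show "n \<le> sms_codim n \<alpha>"
  proof (rule ccontr)
    assume "\<not> n \<le> sms_codim n \<alpha>"
    then have lt: "card {i. i < n \<and> (i, i) \<notin> \<alpha>} + card (missing_arcs n \<alpha>) < n"
      by (simp add: sms_codim_eq_card[OF \<alpha>(1)])
    obtain d where d: "d < n" "(d, d) \<notin> \<alpha>" using stable_sms_if_diagonal \<alpha>(2) by blast
    then have "card {i. i < n \<and> (i, i) \<notin> \<alpha>} \<noteq> 0" by auto
    then have few: "card (missing_arcs n \<alpha>) \<le> n - 2" using lt by linarith
    have "\<exists>r<n. (r, r) \<in> \<alpha>"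
    proof (rule ccontr)
      assume "\<not> ?thesis"
      then have "{i. i < n \<and> (i, i) \<notin> \<alpha>} = {..<n}" by auto
      then show False using lt by simp
    qed
    then show False using stable_sms_if_few_missing_arcs few \<alpha>(2) by blast
  qed
next
  assume "\<exists>\<alpha>. maximally_unstable n \<alpha> \<and> (\<exists>!i. (i, i) \<in> \<alpha>) \<and>
        n \<le> sms_codim n \<alpha> \<and> sms_codim n \<alpha> < 2 * n - 2"
  then obtain \<alpha> r where \<alpha>: "\<alpha> \<subseteq> positions n" "\<not> stable_sms n \<alpha>" and c: "sms_codim n \<alpha> < 2 * n - 2"
    and r: "(r, r) \<in> \<alpha>" "\<And>i. (i, i) \<in> \<alpha> \<Longrightarrow> i = r"
    by (auto simp: maximally_unstable_def)
  have "r < n" using \<alpha>(1) r(1) by (auto simp: positions_def)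
  have "{i. i < n \<and> (i, i) \<notin> \<alpha>} = {..<n} - {r}"
    by (auto simp: r(1) dest: r(2))
  then have "card {i. i < n \<and> (i, i) \<notin> \<alpha>} = n - 1" using \<open>r < n\<close> by simp
  then have "card (missing_arcs n \<alpha>) \<le> n - 2"
    using c by (simp add: sms_codim_eq_card[OF \<alpha>(1)])
  then show False using stable_sms_if_few_missing_arcs[OF \<open>r < n\<close> r(1)] \<alpha>(2) by blast
qed

end
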